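(* Let $a,b$ be real numbers with $a<1$, $ab\geq 1$ and $b$ an integer greater than $2$. Suppose that $ab$ is a root of a Littlewood polynomial of degree $k-1$, namely $\sum_{n=0}^{k-1}\epsilon_n(ab)^n=0$ for some sequence $(\epsilon_n)_{n\in\{0,\dots,k-1\}}$ with values in $\{-1,1\}$. For each $y\in\mathbb{R}$ define the level set $$L(y)=\{x\in[0,1]: T_{a,b}(x)=y\}\times\{y\}.$$ Then there exists $y\in\mathbb{R}$ such that $$\dim_{\mathrm{H}}L(y)\ \geq\ \frac1k .$$
   Context: Let $T:\mathbb{R}\to\mathbb{R}$ be the tent map: the function of period $1$ with $T(x)=x$ for $x\in[0,\frac12]$ and $T(x)=1-x$ for $x\in[\frac12,1]$. The Takagi function is $T_{a,b}(x)=\sum_{n=0}^{\infty}a^nT(b^nx)$. $\dim_{\mathrm{H}}$ denotes Hausdorff dimension. *)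

theory Defs
  imports "HOL-Analysis.Analysis"
begin

definition tent :: "real \<Rightarrow> real" where
  "tent x = (if frac x \<le> 1/2 then frac x else 1 - frac x)"

lemma tent_periodic: "tent (x + 1) = tent x"
  by (simp add: tent_def frac_1_eq)

lemma tent_left: "x \<in> {0..1/2} \<Longrightarrow> tent x = x"
  by (simp add: tent_def frac_eq)

lemma tent_right: "x \<in> {1/2..1} \<Longrightarrow> tent x = 1 - x"
  by (cases "x = 1") (auto simp: tent_def frac_eq)

definition takagi :: "real \<Rightarrow> real \<Rightarrow> real \<Rightarrow> real" where
  "takagi a b x = (\<Sum>n. a ^ n * tent (b ^ n * x))"

definition takagi_level_set :: "real \<Rightarrow> real \<Rightarrow> real \<Rightarrow> (real \<times> real) set" where
  "takagi_level_set a b y = {x \<in> {0..1}. takagi a b x = y} \<times> {y}"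

(* The term diam(U)^s, with the conventions 0^0 = 1 for nonempty U and diam({})^s = 0, so that
   the case s = 0 gives counting measure.  (In the library 0 powr 0 = 0.) *)
definition hausdorff_gauge :: "real \<Rightarrow> 'a::metric_space set \<Rightarrow> real" where
  "hausdorff_gauge s U =
     (if U = {} then 0 else if s = 0 then 1 else diameter U powr s)"

(* Boundedness is required because diameter is real-valued and carries no information on
   unbounded sets.  Finite covers are included by padding with empty sets. *)
definition hausdorff_premeasure :: "real \<Rightarrow> real \<Rightarrow> 'a::metric_space set \<Rightarrow> ennreal" where
  "hausdorff_premeasure s \<delta> A =
     (INF U \<in> {U :: nat \<Rightarrow> 'a set. A \<subseteq> (\<Union>i. U i) \<and> (\<forall>i. bounded (U i) \<and> diameter (U i) \<le> \<delta>)}.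
        \<Sum>i. ennreal (hausdorff_gauge s (U i)))"

definition hausdorff_measure :: "real \<Rightarrow> 'a::metric_space set \<Rightarrow> ennreal" where
  "hausdorff_measure s A = (SUP \<delta> \<in> {0<..}. hausdorff_premeasure s \<delta> A)"

definition hausdorff_dim :: "'a::metric_space set \<Rightarrow> ereal" where
  "hausdorff_dim A = (INF s \<in> {s. 0 \<le> s \<and> hausdorff_measure s A = 0}. ereal s)"

end

(* The function takagi a b is even and 1-periodic, so its level sets may be studied on [0, 1/2],
   with x folded to tent x. Normalise the signs so that the first one is 1. Some interval J in
   [0, 1/2], of length 1 / (2 b^(k-1)), has the property that tent (b^n x) has slope eps_n b^n
   on J for every n < k. Since ab is a root of the Littlewood polynomial, the partial sum F of the
   first k terms of the series is constant on J. By takagi x = F x + a^k takagi (b^k x), the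
   Takagi function is constant on the set of points whose orbit under x |-> tent (b^k x) stays
   in J. That map sends J onto [0, 1/2] with b full affine branches of slope b^k or -b^k, so this
   set is the attractor of b similarities of ratio b^(-k). Coding it by base-b digits and pushing
   forward Lebesgue measure shows that its dimension is at least 1/k. *)

theory Submission
  imports Defs
begin

section \<open>Tent map: symmetries and intervals with prescribed slopes\<close>

lemma tent_add_int: "tent (of_int m + x) = tent x"
proof -
  have "frac (of_int m + x) = frac x"
    by (simp add: frac_def)
  then show ?thesis by (simp add: tent_def)
qed

lemma tent_minus: "tent (- x) = tent x"
proof (cases "x \<in> \<int>")
  case True
  then obtain n where "x = of_int n" by (elim Ints_cases)
  then show ?thesis using tent_add_int[of n 0] tent_add_int[of "- n" 0] by simp
next
  case False
  then show ?thesis by (auto simp: tent_def frac_neg)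
qed

lemma tent_int_diff: "tent (of_int m - x) = tent x"
  using tent_add_int[of m "- x"] by (simp add: tent_minus)

lemma tent_bounds: "0 \<le> tent x" "tent x \<le> 1 / 2"
  using frac_lt_1[of x] by (auto simp: tent_def)

text \<open>An integer translation reduces to one of the two branches on [0, 1]. Taking differences
  cancels the integer offset, so only the parity of \<open>p\<close> remains.\<close>

lemma tent_diff_half_interval:
  fixes p :: nat and x y :: real
  assumes "p / 2 \<le> x" "x \<le> (real p + 1) / 2" "p / 2 \<le> y" "y \<le> (real p + 1) / 2"
  shows "tent x - tent y = (if even p then 1 else - 1) * (x - y)"
proof (cases "even p")
  case True
  then obtain r where r: "p = 2 * r" by blast
  have "tent z = z - r" if "p / 2 \<le> z" "z \<le> (real p + 1) / 2" for z :: real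
    using tent_left[of "z - r"] tent_add_int[of "int r" "z - r"] that r by simp
  from this[of x] this[of y] show ?thesis using assms True by simp
next
  case False
  then obtain r where r: "p = 2 * r + 1" using oddE by blast
  have "tent z = 1 + r - z" if "p / 2 \<le> z" "z \<le> (real p + 1) / 2" for z :: real
    using tent_right[of "z - r"] tent_add_int[of "int r" "z - r"] that r by simp
  from this[of x] this[of y] show ?thesis using assms False by simp
qed

text \<open>Provides the interval J by nested subdivision, fixing one sign per level. The bound on
  \<open>q\<close> keeps J inside [0, 1/2], where \<open>tent\<close> has slope 1; hence the
  condition on the first sign. Difference identities, unlike derivatives, include the
  endpoints.\<close>

lemma tent_slope_itinerary:
  fixes b m :: nat and \<epsilon> :: "nat \<Rightarrow> real"
  assumes "b \<ge> 2" and "\<epsilon> 0 = 1" and "\<forall>n\<le>m. \<epsilon> n \<in> {-1, 1}"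
  obtains q :: nat where "q < b ^ m"
    and "\<And>n (x::real) (y::real). \<lbrakk>n \<le> m; q / (2 * real b ^ m) \<le> x; x \<le> (real q + 1) / (2 * real b ^ m);
          q / (2 * real b ^ m) \<le> y; y \<le> (real q + 1) / (2 * real b ^ m)\<rbrakk>
          \<Longrightarrow> tent (real b ^ n * x) - tent (real b ^ n * y) = \<epsilon> n * real b ^ n * (x - y)"
  using assms(3)
proof (induction m arbitrary: thesis)
  case 0
  show thesis
    by (rule 0(1)[of 0]) (use tent_left assms(2) in auto)
next
  case (Suc m)
  obtain q where q: "q < b ^ m"
    and IH: "\<And>n (x::real) (y::real). \<lbrakk>n \<le> m; q / (2 * real b ^ m) \<le> x; x \<le> (real q + 1) / (2 * real b ^ m);
          q / (2 * real b ^ m) \<le> y; y \<le> (real q + 1) / (2 * real b ^ m)\<rbrakk>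
          \<Longrightarrow> tent (real b ^ n * x) - tent (real b ^ n * y) = \<epsilon> n * real b ^ n * (x - y)"
  proof (rule Suc.IH)
    show "\<forall>n\<le>m. \<epsilon> n \<in> {-1, 1}" using Suc.prems(2) by simp
  qed (rule that)
  have e: "\<epsilon> (Suc m) \<in> {-1, 1}" using Suc.prems(2) by blast
  \<comment> \<open>The parent interval splits into \<open>b\<close> cells with indices from
    \<open>b * q\<close> on. Since \<open>b\<close> is at least 2, two neighbouring cells of
    opposite parity are available, and parity decides the slope at the new level.\<close>
  obtain p where p: "p = b * q \<or> p = b * q + 1"
    and par: "(if even p then 1 else - 1) = \<epsilon> (Suc m)"
  proof (cases "even (b * q) = (\<epsilon> (Suc m) = 1)")
    case True
    then show thesis using that[of "b * q"] e by auto
  next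
    case False
    then show thesis using that[of "b * q + 1"] e by auto
  qed
  have lo: "b * q \<le> p" and hi: "p + 1 \<le> b * (q + 1)"
    using p assms(1) by auto
  have "b * (q + 1) \<le> b ^ Suc m"
    using q by (simp add: Suc_leI del: mult_Suc_right)
  with hi have "p < b ^ Suc m" by linarith
  moreover have "tent (real b ^ n * x) - tent (real b ^ n * y) = \<epsilon> n * real b ^ n * (x - y)"
    if n: "n \<le> Suc m"
      and x: "p / (2 * real b ^ Suc m) \<le> x" "x \<le> (real p + 1) / (2 * real b ^ Suc m)"
      and y: "p / (2 * real b ^ Suc m) \<le> y" "y \<le> (real p + 1) / (2 * real b ^ Suc m)" for n and x y :: real
  proof (cases "n = Suc m")
    case True
    have "real b ^ n > 0" using assms(1) by simp
    then have "p / 2 \<le> real b ^ n * x" "real b ^ n * x \<le> (real p + 1) / 2" "p / 2 \<le> real b ^ n * y" "real b ^ n * y \<le> (real p + 1) / 2"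
      using x y unfolding True[symmetric] by (simp_all add: field_simps)
    from tent_diff_half_interval[OF this] show ?thesis
      using par True by (simp add: algebra_simps)
  next
    case False
    have pos: "real b > 0" "real b ^ m > 0" using assms(1) by simp_all
    have "q / (2 * real b ^ m) = real b * real q / (2 * real b ^ Suc m)" using pos by simp
    also have "\<dots> \<le> p / (2 * real b ^ Suc m)"
      using lo by (intro divide_right_mono) (simp_all flip: of_nat_mult)
    finally have 1: "q / (2 * real b ^ m) \<le> p / (2 * real b ^ Suc m)" .
    have "(real p + 1) / (2 * real b ^ Suc m) \<le> b * (real q + 1) / (2 * real b ^ Suc m)"
      using of_nat_mono[OF hi, where 'a = real]
      by (intro divide_right_mono) (simp_all add: algebra_simps)
    also have "\<dots> = (real q + 1) / (2 * real b ^ m)" using pos by simp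
    finally have 2: "(real p + 1) / (2 * real b ^ Suc m) \<le> (real q + 1) / (2 * real b ^ m)" .
    show ?thesis
      by (rule IH) (use n False 1 2 x y in linarith)+
  qed
  ultimately show thesis using Suc.prems(1) by blast
qed

section \<open>Takagi series: convergence, self-similarity and symmetries\<close>

context
  fixes a b :: real
  assumes a: "0 < a" "a < 1"
begin

lemma takagi_term_bound: "norm (a ^ n * tent x) \<le> a ^ n * (1 / 2)"
  using a tent_bounds[of x] by (simp add: abs_mult)

lemma takagi_summable: "summable (\<lambda>n. a ^ n * tent (b ^ n * x))"
  for x :: real
proof (rule summable_comparison_test)
  show "summable (\<lambda>n. a ^ n * (1 / 2))"
    using a by (intro summable_mult2 summable_geometric) simp
qed (use takagi_term_bound in blast)

lemma takagi_bound: "\<bar>takagi a b x\<bar> \<le> 1 / (2 * (1 - a))"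
proof -
  have s: "summable (\<lambda>n. a ^ n)" using a by (intro summable_geometric) simp
  have "norm (takagi a b x) \<le> (\<Sum>n. a ^ n * (1 / 2))"
    unfolding takagi_def
    by (rule norm_suminf_le[OF takagi_term_bound summable_mult2[OF s]])
  also have "\<dots> = (\<Sum>n. a ^ n) * (1 / 2)" by (rule suminf_mult2[OF s, symmetric])
  also have "\<dots> = 1 / (2 * (1 - a))" using a by (subst suminf_geometric) auto
  finally show ?thesis by simp
qed

lemma takagi_split:
  "takagi a b x = (\<Sum>n<k. a ^ n * tent (b ^ n * x)) + a ^ k * takagi a b (b ^ k * x)"
  for x :: real
proof -
  have "takagi a b x = (\<Sum>n. a ^ (n + k) * tent (b ^ (n + k) * x))
      + (\<Sum>n<k. a ^ n * tent (b ^ n * x))"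
    unfolding takagi_def by (rule suminf_split_initial_segment[OF takagi_summable])
  also have "(\<Sum>n. a ^ (n + k) * tent (b ^ (n + k) * x)) = a ^ k * takagi a b (b ^ k * x)"
    unfolding takagi_def
    by (subst suminf_mult[OF takagi_summable, symmetric]) (simp add: power_add mult_ac)
  finally show ?thesis by simp
qed

end

text \<open>For integer \<open>b\<close> each \<open>b ^ n * m\<close> is an integer, so every term
  inherits the period of \<open>tent\<close>. With the reflection below, this shows that folding a
  point into [0, 1/2] preserves the value of \<open>takagi\<close>.\<close>

lemma takagi_add_int:
  fixes b :: nat and x :: real
  shows "takagi a (real b) (of_int m + x) = takagi a (real b) x"
proof -
  have "tent (real b ^ n * (of_int m + x)) = tent (real b ^ n * x)" for n
    using tent_add_int[of "int b ^ n * m" "real b ^ n * x"] by (simp add: algebra_simps)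
  then show ?thesis by (simp add: takagi_def)
qed

lemma takagi_int_diff:
  fixes b :: nat and x :: real
  shows "takagi a (real b) (of_int m - x) = takagi a (real b) x"
proof -
  have "tent (real b ^ n * (of_int m - x)) = tent (real b ^ n * x)" for n
    using tent_int_diff[of "int b ^ n * m" "real b ^ n * x"] by (simp add: algebra_simps)
  then show ?thesis by (simp add: takagi_def)
qed

section \<open>Coding points by itineraries of the folded map\<close>

text \<open>The point with itinerary \<open>e z, e (R z), e (R (R z)), \<dots>\<close> under the folded map
  \<open>t \<mapsto> tent (B * t)\<close>, which maps each interval \<open>[i / (2 * B), (i + 1) / (2 * B)]\<close> with
  \<open>i < B\<close> affinely onto \<open>[0, 1/2]\<close>. The series is centred at the midpoint \<open>1/4\<close>, so that its
  terms are bounded by a geometric series with sum exactly \<open>1/4\<close>.\<close>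

lemma folded_coding_exists:
  fixes B :: nat and e :: "'z \<Rightarrow> nat" and R :: "'z \<Rightarrow> 'z"
  assumes B: "B \<ge> 2" and e: "\<And>z. e z < B"
  obtains \<Phi> :: "'z \<Rightarrow> real" where "\<And>z. 0 \<le> \<Phi> z" "\<And>z. \<Phi> z \<le> 1 / 2"
    and "\<And>z. B * \<Phi> z = (if even (e z) then e z / 2 + \<Phi> (R z) else (real (e z) + 1) / 2 - \<Phi> (R z))"
proof -
  \<comment> \<open>The centred point \<open>\<Phi> z - 1/4\<close> has to satisfy x(z) = w(z) +
    s(z) x(R z), with the sign of s recording the orientation of the branch; \<open>t z j\<close> is
    the j-th term obtained by unrolling this.\<close>
  define s :: "'z \<Rightarrow> real" where "s z = (if even (e z) then 1 / B else - 1 / B)" for z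
  define w :: "'z \<Rightarrow> real" where "w z = (2 * e z + 1) / (4 * B) - 1 / 4" for z
  define t where "t z j = (\<Prod>i<j. s ((R ^^ i) z)) * w ((R ^^ j) z)" for z j
  define \<Phi> where "\<Phi> z = 1 / 4 + (\<Sum>j. t z j)" for z
  have s: "\<bar>s z\<bar> = 1 / B" for z by (simp add: s_def)
  have w: "\<bar>w z\<bar> \<le> (1 - 1 / B) / 4" for z
  proof -
    have "w z = (2 * real (e z) + 1 - B) / (4 * B)"
      using B by (simp add: w_def field_simps)
    moreover have "\<bar>2 * real (e z) + 1 - B\<bar> \<le> B - 1"
      using e[of z] by linarith
    ultimately have "\<bar>w z\<bar> \<le> (real B - 1) / (4 * B)"
      using B by (simp add: divide_right_mono)
    also have "\<dots> = (1 - 1 / B) / 4" using B by (simp add: field_simps)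
    finally show ?thesis .
  qed
  have t: "norm (t z j) \<le> (1 / B) ^ j * ((1 - 1 / B) / 4)" for z j
  proof -
    have "norm (t z j) = (1 / B) ^ j * \<bar>w ((R ^^ j) z)\<bar>"
      by (simp add: t_def abs_mult abs_prod s)
    also have "\<dots> \<le> (1 / B) ^ j * ((1 - 1 / B) / 4)"
      using w by (intro mult_left_mono) auto
    finally show ?thesis .
  qed
  have geo: "summable (\<lambda>j. (1 / real B) ^ j)"
    using B by (intro summable_geometric) simp
  have sum: "summable (t z)" for z
    by (rule summable_comparison_test[OF _ summable_mult2[OF geo]]) (use t in blast)
  have "norm (suminf (t z)) \<le> (\<Sum>j. (1 / real B) ^ j * ((1 - 1 / B) / 4))" for z
    by (rule norm_suminf_le[OF t summable_mult2[OF geo]])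
  also have "(\<Sum>j. (1 / real B) ^ j * ((1 - 1 / B) / 4)) = (\<Sum>j. (1 / real B) ^ j) * ((1 - 1 / B) / 4)"
    by (rule suminf_mult2[OF geo, symmetric])
  also have "\<dots> = 1 / 4"
    using B by (subst suminf_geometric) (auto simp: field_simps)
  finally have bd: "\<bar>suminf (t z)\<bar> \<le> 1 / 4" for z by simp
  have rec: "suminf (t z) = w z + s z * suminf (t (R z))" for z
  proof -
    have "t z (Suc j) = s z * t (R z) j" for j
      by (simp add: t_def prod.lessThan_Suc_shift funpow_Suc_right del: funpow.simps prod.lessThan_Suc)
    moreover have "t z 0 = w z" by (simp add: t_def)
    ultimately show ?thesis
      using suminf_split_head[OF sum[of z]] suminf_mult[OF sum[of "R z"], of "s z"] by simp
  qed
  show thesis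
  proof
    fix z
    show "0 \<le> \<Phi> z" "\<Phi> z \<le> 1 / 2" using bd[of z] by (auto simp: \<Phi>_def)
    show "B * \<Phi> z = (if even (e z) then e z / 2 + \<Phi> (R z) else (real (e z) + 1) / 2 - \<Phi> (R z))"
      using rec[of z] B by (auto simp: \<Phi>_def s_def w_def field_simps)
  qed
qed

section \<open>Recovering base-b digits from cell indices\<close>

text \<open>Splits the leading digit off a base-b expansion: the integer
  \<open>b ^ n * \<lfloor>b * z\<rfloor>\<close> leaves the floor.\<close>

lemma floor_mult_shift:
  fixes b n :: nat and z :: real
  shows "\<lfloor>real b ^ Suc n * z\<rfloor> = int b ^ n * \<lfloor>b * z\<rfloor> + \<lfloor>real b ^ n * frac (b * z)\<rfloor>"
proof -
  have "real b ^ Suc n * z = of_int (int b ^ n * \<lfloor>b * z\<rfloor>) + real b ^ n * frac (b * z)"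
    by (simp add: frac_def algebra_simps)
  then show ?thesis by (simp only: int_add_floor)
qed

text \<open>A discrete inverse of the coding. \<open>m z\<close> names a cell of length 1 / (2 B^n)
  containing \<open>\<Phi> z\<close>; it is built from the digits of \<open>z\<close>, which settles
  the choice at common endpoints, and it determines the first n digits.\<close>

lemma folded_coding_index:
  fixes b q B n :: nat and \<Phi> :: "real \<Rightarrow> real"
  assumes B: "B > 0"
    and e: "\<And>z::real. b * q + nat \<lfloor>b * frac z\<rfloor> < B"
    and range: "\<And>z::real. 0 \<le> \<Phi> z" "\<And>z::real. \<Phi> z \<le> 1 / 2"
    and rec: "\<And>z::real. B * \<Phi> z = (let e = b * q + nat \<lfloor>b * frac z\<rfloor> in
        if even e then e / 2 + \<Phi> (frac (b * z)) else (real e + 1) / 2 - \<Phi> (frac (b * z)))"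
  obtains m :: "real \<Rightarrow> nat" where "\<And>z::real. m z < B ^ n"
    and "\<And>z::real. m z \<le> 2 * real B ^ n * \<Phi> z" "\<And>z::real. 2 * real B ^ n * \<Phi> z \<le> real (m z) + 1"
    and "\<And>(z::real) z'::real. \<lbrakk>z \<in> {0..<1}; z' \<in> {0..<1}; m z = m z'\<rbrakk>
          \<Longrightarrow> \<lfloor>real b ^ n * z\<rfloor> = \<lfloor>real b ^ n * z'\<rfloor>"
proof (induction n arbitrary: thesis)
  case 0
  show thesis
  proof (rule 0[of "\<lambda>_. 0"])
    fix z z' :: real assume "z \<in> {0..<1}" "z' \<in> {0..<1}"
    then have "\<lfloor>z\<rfloor> = 0" "\<lfloor>z'\<rfloor> = 0" by (simp_all add: floor_eq_iff)
    then show "\<lfloor>real b ^ 0 * z\<rfloor> = \<lfloor>real b ^ 0 * z'\<rfloor>" by simp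
  qed (use range in \<open>auto simp: field_simps\<close>)
next
  case (Suc n)
  obtain m :: "real \<Rightarrow> nat" where m: "\<And>z::real. m z < B ^ n"
    and lo: "\<And>z::real. m z \<le> 2 * real B ^ n * \<Phi> z" and hi: "\<And>z::real. 2 * real B ^ n * \<Phi> z \<le> real (m z) + 1"
    and inj: "\<And>(z::real) z'::real. \<lbrakk>z \<in> {0..<1}; z' \<in> {0..<1}; m z = m z'\<rbrakk>
          \<Longrightarrow> \<lfloor>real b ^ n * z\<rfloor> = \<lfloor>real b ^ n * z'\<rfloor>"
    by (rule Suc.IH) (rule that)
  define e where "e z = b * q + nat \<lfloor>b * frac z\<rfloor>" for z :: real
  \<comment> \<open>Position of \<open>\<Phi> z\<close> among the \<open>B ^ n\<close> subcells of
    cell \<open>e z\<close>. An odd branch reverses orientation, so position j becomes B^n - 1 -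
    j.\<close>
  define r where "r z = (if even (e z) then m (frac (b * z)) else B ^ n - 1 - m (frac (b * z)))" for z :: real
  have r: "r z < B ^ n" for z using m[of "frac (b * z)"] by (auto simp: r_def)
  have step: "2 * real B ^ Suc n * \<Phi> z = real (e z) * real B ^ n +
      (if even (e z) then 2 * real B ^ n * \<Phi> (frac (b * z)) else real B ^ n - 2 * real B ^ n * \<Phi> (frac (b * z)))" for z :: real
  proof -
    have "2 * real B ^ Suc n * \<Phi> z = 2 * real B ^ n * (B * \<Phi> z)" by simp
    also have "\<dots> = real (e z) * real B ^ n +
      (if even (e z) then 2 * real B ^ n * \<Phi> (frac (b * z)) else real B ^ n - 2 * real B ^ n * \<Phi> (frac (b * z)))"
      unfolding rec[of z] Let_def e_def[symmetric] by (simp add: algebra_simps)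
    finally show ?thesis .
  qed
  have real_r: "real (r z) = (if even (e z) then real (m (frac (b * z)))
      else real B ^ n - 1 - real (m (frac (b * z))))" for z :: real
  proof -
    have "real (B ^ n - 1 - m (frac (b * z))) = real (B ^ n) - 1 - real (m (frac (b * z)))"
      using m[of "frac (b * z)"] by (simp add: of_nat_diff del: of_nat_power)
    then show ?thesis by (simp add: r_def)
  qed
  show thesis
  proof (rule Suc.prems[of "\<lambda>z::real. e z * B ^ n + r z"])
    fix z :: real
    have "e z * B ^ n + r z < (e z + 1) * B ^ n" using r[of z] by simp
    also have "\<dots> \<le> B * B ^ n" using e[of z] by (intro mult_right_mono) (auto simp: e_def)
    finally show "e z * B ^ n + r z < B ^ Suc n" by simp
    show "real (e z * B ^ n + r z) \<le> 2 * real B ^ Suc n * \<Phi> z"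
      using hi[of "frac (b * z)"] lo[of "frac (b * z)"] step[of z] real_r[of z]
      by (simp del: power_Suc split: if_splits)
    show "2 * real B ^ Suc n * \<Phi> z \<le> real (e z * B ^ n + r z) + 1"
      using hi[of "frac (b * z)"] lo[of "frac (b * z)"] step[of z] real_r[of z]
      by (simp del: power_Suc split: if_splits)
  next
    fix z z' :: real
    assume z: "z \<in> {0..<1}" "z' \<in> {0..<1}" and eq: "e z * B ^ n + r z = e z' * B ^ n + r z'"
    \<comment> \<open>Since \<open>r z < B ^ n\<close>, the first-level cell and the position inside
      it are the quotient and remainder of the index by \<open>B ^ n\<close>.\<close>
    have "e z = (e z * B ^ n + r z) div B ^ n" for z using r[of z] B by simp
    with eq have ee: "e z = e z'" by metis
    with eq have "r z = r z'" by simp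
    then have "m (frac (b * z)) = m (frac (b * z'))"
      using m[of "frac (b * z)"] m[of "frac (b * z')"] ee by (auto simp: r_def split: if_splits)
    then have 1: "\<lfloor>real b ^ n * frac (b * z)\<rfloor> = \<lfloor>real b ^ n * frac (b * z')\<rfloor>"
      by (intro inj) (auto simp: frac_lt_1)
    have "nat \<lfloor>b * z\<rfloor> = nat \<lfloor>b * z'\<rfloor>"
      using ee z by (simp add: e_def frac_eq[THEN iffD2])
    moreover have "0 \<le> \<lfloor>b * z\<rfloor>" "0 \<le> \<lfloor>b * z'\<rfloor>" using z by simp_all
    ultimately have "\<lfloor>b * z\<rfloor> = \<lfloor>b * z'\<rfloor>" by linarith
    with 1 show "\<lfloor>real b ^ Suc n * z\<rfloor> = \<lfloor>real b ^ Suc n * z'\<rfloor>"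
      unfolding floor_mult_shift by simp
  qed
qed

text \<open>\<open>P\<close> will be a preimage under the coding, whose measurability is not
  established; its size is therefore measured by a Borel superset made of b-adic intervals.\<close>

lemma cover_by_digit_intervals:
  fixes b :: nat and P :: "real set" and I :: "int set"
  assumes "b > 0" and "finite I" and "\<And>z::real. z \<in> P \<Longrightarrow> \<lfloor>real b ^ n * z\<rfloor> \<in> I"
  obtains Q where "Q \<in> sets lborel" "P \<subseteq> Q" "emeasure lborel Q \<le> ennreal (card I / b ^ n)"
proof -
  define Q where "Q = (\<Union>i\<in>I. {i / b ^ n..(real_of_int i + 1) / b ^ n :: real})"
  have pos: "real b ^ n > 0" using assms(1) by simp
  have "P \<subseteq> Q"
  proof
    fix z assume "z \<in> P"
    moreover have "z \<in> {\<lfloor>real b ^ n * z\<rfloor> / b ^ n..(real_of_int \<lfloor>real b ^ n * z\<rfloor> + 1) / b ^ n :: real}"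
    proof -
      have "\<lfloor>real b ^ n * z\<rfloor> \<le> real b ^ n * z" "real b ^ n * z \<le> real_of_int \<lfloor>real b ^ n * z\<rfloor> + 1"
        by linarith+
      then show ?thesis using pos by (simp add: field_simps)
    qed
    ultimately show "z \<in> Q"
      unfolding Q_def using assms(3) by (intro UN_I)
  qed
  moreover have "Q \<in> sets lborel"
    unfolding Q_def using assms(2) by (intro sets.finite_UN) auto
  moreover have "emeasure lborel Q \<le> ennreal (card I / b ^ n)"
  proof -
    have "emeasure lborel Q \<le> (\<Sum>i\<in>I. emeasure lborel {i / b ^ n..(real_of_int i + 1) / b ^ n :: real})"
      unfolding Q_def by (intro emeasure_subadditive_finite assms(2)) auto
    also have "\<dots> = (\<Sum>i\<in>I. ennreal (1 / b ^ n))"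
    proof (rule sum.cong)
      fix i :: int
      have "i / b ^ n \<le> (real_of_int i + 1) / b ^ n" using pos by (intro divide_right_mono) auto
      moreover have "(real_of_int i + 1) / b ^ n - i / b ^ n = 1 / b ^ n" by (simp add: add_divide_distrib)
      ultimately show "emeasure lborel {i / b ^ n..(real_of_int i + 1) / b ^ n :: real} = ennreal (1 / b ^ n)"
        by simp
    qed simp
    also have "\<dots> = ennreal (card I / b ^ n)"
      by (simp add: ennreal_mult' ennreal_of_nat_eq_real_of_nat flip: ennreal_mult)
    finally show ?thesis .
  qed
  ultimately show thesis using that by blast
qed

section \<open>Lower bounds for Hausdorff dimension from Lebesgue measure\<close>

text \<open>A form of the mass distribution principle, for the image of Lebesgue measure under \<open>f\<close>.\<close>

lemma hausdorff_dim_ge: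
  fixes A :: "'a::metric_space set" and f :: "real \<Rightarrow> 'a" and b N c :: real and k :: nat
  assumes f: "f ` {0..<1} \<subseteq> A" and k: "k > 0" and b: "b > 1" and N: "N > 0" and c: "0 < c" "c \<le> 1"
    and cover: "\<And>U n. \<lbrakk>bounded U; diameter U \<le> c / (b ^ k) ^ n\<rbrakk> \<Longrightarrow>
      \<exists>Q\<in>sets lborel. {z \<in> {0..<1}. f z \<in> U} \<subseteq> Q \<and> emeasure lborel Q \<le> ennreal (N / b ^ n)"
  shows "hausdorff_dim A \<ge> ereal (1 / k)"
proof -
  \<comment> \<open>\<open>N\<close> comes from the covering hypothesis, \<open>b\<close> pays for
    passing from scale n to n - 1, and the last factor for raising c / (b^k)^n < diam U to the power
    1/k.\<close>
  define C where "C = N * b * (1 / c) powr (1 / k)"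
  have C: "C > 0" using b N c by (simp add: C_def)
  have bk: "b ^ k > 1" using b k by simp
  have single: "\<exists>Q\<in>sets lborel. {z \<in> {0..<1}. f z \<in> U} \<subseteq> Q \<and>
      emeasure lborel Q \<le> ennreal C * ennreal (hausdorff_gauge s U)"
    if s: "0 \<le> s" "s < 1 / k" and U: "bounded U" "diameter U \<le> c" for s U
  proof (cases "diameter U = 0")
    case True
    \<comment> \<open>Diameter 0 meets the covering hypothesis at every scale, so intersecting the
      covers gives a null set; this suffices for any value of the gauge, including the case s =
      0.\<close>
    have "\<forall>n. \<exists>Q\<in>sets lborel. {z \<in> {0..<1}. f z \<in> U} \<subseteq> Q \<and> emeasure lborel Q \<le> ennreal (N / b ^ n)"
      using cover[OF U(1)] True c b by simp
    then obtain Q where Q: "\<And>n. Q n \<in> sets lborel" "\<And>n. {z \<in> {0..<1}. f z \<in> U} \<subseteq> Q n"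
      "\<And>n. emeasure lborel (Q n) \<le> ennreal (N / b ^ n)" by metis
    have "emeasure lborel (\<Inter>n. Q n) \<le> ennreal (N / b ^ n)" for n
      using emeasure_mono[of "\<Inter>n. Q n" "Q n" lborel] Q(1,3)[of n] by (meson INT_lower UNIV_I order_trans)
    moreover have "(\<lambda>n. ennreal (N / b ^ n)) \<longlonglongrightarrow> ennreal 0"
      by (intro tendsto_ennrealI) (use b in real_asymp)
    ultimately have "emeasure lborel (\<Inter>n. Q n) \<le> ennreal 0"
      by (intro LIMSEQ_le_const) auto
    moreover have "(\<Inter>n. Q n) \<in> sets lborel" using Q(1) by (intro sets.countable_INT) auto
    ultimately show ?thesis using Q(2) by (intro bexI[of _ "\<Inter>n. Q n"]) auto
  next
    case False
    then have d: "diameter U > 0" using diameter_ge_0[OF U(1)] by simp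
    then have ne: "U \<noteq> {}" by auto
    have "\<exists>n. c / diameter U < (b ^ k) ^ n" using real_arch_pow[OF bk] .
    then have ex: "\<exists>n. \<not> diameter U \<le> c / (b ^ k) ^ n"
      using d bk by (auto simp: field_simps not_le)
    \<comment> \<open>The first scale finer than \<open>U\<close>. It is not 0 because diam U is at
      most c, so the preceding scale exists and still admits a cover.\<close>
    define n where "n = (LEAST n. \<not> diameter U \<le> c / (b ^ k) ^ n)"
    have n: "diameter U > c / (b ^ k) ^ n" using LeastI_ex[OF ex] unfolding n_def by simp
    have "n \<noteq> 0" using n U(2) by (intro notI) simp
    then obtain m where m: "n = Suc m" using not0_implies_Suc by blast
    have "diameter U \<le> c / (b ^ k) ^ m"
      using not_less_Least[of m "\<lambda>n. \<not> diameter U \<le> c / (b ^ k) ^ n"] m unfolding n_def by auto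
    then obtain Q where Q: "Q \<in> sets lborel" "{z \<in> {0..<1}. f z \<in> U} \<subseteq> Q"
      "emeasure lborel Q \<le> ennreal (N / b ^ m)" using cover[OF U(1)] by blast
    have "1 / b ^ n = (1 / (b ^ k) ^ n) powr (1 / k)"
    proof -
      have "(1 / (b ^ k) ^ n) powr (1 / k) = (b powr (- real (k * n))) powr (1 / k)"
        using b by (subst powr_minus, subst powr_realpow) (auto simp: power_mult field_simps)
      also have "\<dots> = b powr (- real n)" using k by (simp add: powr_powr)
      also have "\<dots> = 1 / b ^ n" using b by (simp add: powr_minus powr_realpow field_simps)
      finally show ?thesis ..
    qed
    also have "\<dots> \<le> (1 / c * diameter U) powr (1 / k)"
      using n c b by (intro powr_mono2) (auto simp: field_simps)
    also have "\<dots> = (1 / c) powr (1 / k) * diameter U powr (1 / k)"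
      using c d by (subst powr_mult) auto
    finally have "N * b * (1 / b ^ n) \<le> C * diameter U powr (1 / k)"
      unfolding C_def mult.assoc using N b by (intro mult_left_mono) auto
    \<comment> \<open>As diam U is at most c, hence at most 1, lowering the exponent from 1/k to s
      increases the power.\<close>
    also have "\<dots> \<le> C * diameter U powr s"
      using C d U(2) c s by (intro mult_left_mono powr_mono') auto
    also have "diameter U powr s = hausdorff_gauge s U"
      using ne d by (simp add: hausdorff_gauge_def)
    finally have "N / b ^ m \<le> C * hausdorff_gauge s U" using b m by simp
    then have "ennreal (N / b ^ m) \<le> ennreal C * ennreal (hausdorff_gauge s U)"
      using C by (subst ennreal_mult[symmetric]) (auto simp: hausdorff_gauge_def intro: ennreal_leI)
    with Q show ?thesis by (meson order_trans)
  qed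
  \<comment> \<open>The preimages of a cover of \<open>A\<close> cover [0, 1), of Lebesgue measure
    1, so the gauges sum to at least 1 / C. The single scale \<open>c\<close> is enough, the measure
    being a supremum over scales.\<close>
  have "hausdorff_measure s A \<noteq> 0" if s: "0 \<le> s" "s < 1 / k" for s
  proof -
    have "ennreal (1 / C) \<le> hausdorff_premeasure s c A"
      unfolding hausdorff_premeasure_def
    proof (rule INF_greatest)
      fix U :: "nat \<Rightarrow> 'a set"
      assume "U \<in> {U. A \<subseteq> (\<Union>i. U i) \<and> (\<forall>i. bounded (U i) \<and> diameter (U i) \<le> c)}"
      then have A: "A \<subseteq> (\<Union>i. U i)" and U: "\<And>i. bounded (U i)" "\<And>i. diameter (U i) \<le> c" by auto
      have "\<forall>i. \<exists>Q\<in>sets lborel. {z \<in> {0..<1}. f z \<in> U i} \<subseteq> Q \<and>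
          emeasure lborel Q \<le> ennreal C * ennreal (hausdorff_gauge s (U i))"
        using single[OF s U] by blast
      then obtain Q where Q: "\<And>i. Q i \<in> sets lborel" "\<And>i. {z \<in> {0..<1}. f z \<in> U i} \<subseteq> Q i"
        "\<And>i. emeasure lborel (Q i) \<le> ennreal C * ennreal (hausdorff_gauge s (U i))" by metis
      have "{0..<1} \<subseteq> (\<Union>i. Q i)"
      proof
        fix z :: real assume z: "z \<in> {0..<1}"
        then obtain i where "f z \<in> U i" using f A by blast
        then show "z \<in> (\<Union>i. Q i)" using Q(2)[of i] z by blast
      qed
      then have "emeasure lborel {0..<1::real} \<le> emeasure lborel (\<Union>i. Q i)"
        using Q(1) by (intro emeasure_mono) auto
      also have "\<dots> \<le> (\<Sum>i. emeasure lborel (Q i))"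
        using Q(1) by (intro emeasure_subadditive_countably) auto
      also have "\<dots> \<le> (\<Sum>i. ennreal C * ennreal (hausdorff_gauge s (U i)))"
        by (intro suminf_le Q(3)) auto
      also have "\<dots> = ennreal C * (\<Sum>i. ennreal (hausdorff_gauge s (U i)))"
        by (rule ennreal_suminf_cmult)
      finally have "1 \<le> ennreal C * (\<Sum>i. ennreal (hausdorff_gauge s (U i)))" by simp
      then have "ennreal (1 / C) * 1 \<le> ennreal (1 / C) * (ennreal C * (\<Sum>i. ennreal (hausdorff_gauge s (U i))))"
        by (intro mult_left_mono) auto
      also have "\<dots> = (\<Sum>i. ennreal (hausdorff_gauge s (U i)))"
        using C by (simp add: mult.assoc[symmetric] ennreal_mult[symmetric])
      finally show "ennreal (1 / C) \<le> (\<Sum>i. ennreal (hausdorff_gauge s (U i)))" by simp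
    qed
    also have "\<dots> \<le> hausdorff_measure s A"
      unfolding hausdorff_measure_def using c by (intro SUP_upper) auto
    finally show ?thesis using C by auto
  qed
  then show ?thesis
    unfolding hausdorff_dim_def by (intro INF_greatest) (auto simp: not_less[symmetric])
qed

section \<open>The coded subset of a level set and its dimension\<close>

lemma takagi_level_set_dim:
  fixes a :: real and b k :: nat and \<epsilon> :: "nat \<Rightarrow> real"
  assumes a: "0 < a" "a < 1" and b: "b \<ge> 2" and k: "k \<ge> 1"
    and \<epsilon>: "\<epsilon> 0 = 1" "\<forall>n<k. \<epsilon> n \<in> {-1, 1}" and root: "(\<Sum>n<k. \<epsilon> n * (a * b) ^ n) = 0"
  shows "\<exists>y. hausdorff_dim (takagi_level_set a b y) \<ge> ereal (1 / k)"
proof -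
  obtain l where l: "k = Suc l" using k by (cases k) auto
  define B where "B = b ^ k"
  have B: "B \<ge> 2" using order_trans[OF b self_le_power[of b k]] b k by (simp add: B_def)
  obtain q where q: "q < b ^ l"
    and slopes: "\<And>n (x::real) (y::real). \<lbrakk>n \<le> l; q / (2 * real b ^ l) \<le> x; x \<le> (real q + 1) / (2 * real b ^ l);
          q / (2 * real b ^ l) \<le> y; y \<le> (real q + 1) / (2 * real b ^ l)\<rbrakk>
          \<Longrightarrow> tent (real b ^ n * x) - tent (real b ^ n * y) = \<epsilon> n * real b ^ n * (x - y)"
    by (rule tent_slope_itinerary[OF b \<epsilon>(1) \<epsilon>(2)[unfolded l less_Suc_eq_le]]) (rule that)
  define J where "J = {q / (2 * real b ^ l)..(real q + 1) / (2 * real b ^ l)}"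
  define F where "F x = (\<Sum>n<k. a ^ n * tent (real b ^ n * x))" for x :: real
  have F: "F x = F y" if "x \<in> J" "y \<in> J" for x y :: real
  proof -
    \<comment> \<open>Each term is affine on J with slope \<open>\<epsilon> n * (a * b) ^ n\<close>,
      so the slope of \<open>F\<close> is the Littlewood polynomial at \<open>a * b\<close>.\<close>
    have "F x - F y = (\<Sum>n<k. a ^ n * (tent (real b ^ n * x) - tent (real b ^ n * y)))"
      by (simp add: F_def sum_subtractf right_diff_distrib)
    also have "\<dots> = (\<Sum>n<k. \<epsilon> n * (a * b) ^ n * (x - y))"
    proof (rule sum.cong)
      fix n assume "n \<in> {..<k}"
      then have "tent (real b ^ n * x) - tent (real b ^ n * y) = \<epsilon> n * real b ^ n * (x - y)"
        using that l by (intro slopes) (auto simp: J_def)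
      then show "a ^ n * (tent (real b ^ n * x) - tent (real b ^ n * y)) = \<epsilon> n * (a * b) ^ n * (x - y)"
        by (simp add: power_mult_distrib)
    qed simp
    also have "\<dots> = 0" by (simp add: root flip: sum_distrib_right)
    finally show ?thesis by simp
  qed
  \<comment> \<open>J is the union of the \<open>b\<close> cells of length 1 / (2 B) with indices
    from \<open>b * q\<close> to \<open>b * q + b - 1\<close>; the leading base-b digit of
    \<open>z\<close> selects one.\<close>
  define e where "e z = b * q + nat \<lfloor>b * frac z\<rfloor>" for z :: real
  have digit: "nat \<lfloor>b * frac z\<rfloor> < b" for z :: real
  proof -
    have "b * frac z < b" using frac_lt_1[of z] b by simp
    then have "\<lfloor>b * frac z\<rfloor> < int b" by (simp add: floor_less_iff)
    then show ?thesis using b by linarith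
  qed
  have bq: "b * (q + 1) \<le> B"
    using q by (simp add: B_def l Suc_leI del: mult_Suc_right)
  have e: "e z < B" for z using digit[of z] bq by (simp add: e_def)
  obtain \<Phi> :: "real \<Rightarrow> real" where \<Phi>: "\<And>z::real. 0 \<le> \<Phi> z" "\<And>z::real. \<Phi> z \<le> 1 / 2"
    and rec: "\<And>z::real. B * \<Phi> z = (if even (e z) then e z / 2 + \<Phi> (frac (b * z))
        else (real (e z) + 1) / 2 - \<Phi> (frac (b * z)))"
    by (rule folded_coding_exists[of B e "\<lambda>z. frac (b * z)", OF B e]) (rule that)
  have J: "\<Phi> z \<in> J" for z :: real
  proof -
    have "e z / 2 \<le> B * \<Phi> z" "B * \<Phi> z \<le> (real (e z) + 1) / 2"
      using rec[of z] \<Phi>[of "frac (b * z)"] by (auto simp: field_simps split: if_splits)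
    moreover have "b * q \<le> e z" "e z + 1 \<le> b * (q + 1)"
      using digit[of z] by (auto simp: e_def)
    from this[THEN of_nat_mono, where 'a = real]
    have "real b * q \<le> e z" "real (e z) + 1 \<le> real b * (real q + 1)"
      by (simp_all add: algebra_simps)
    ultimately have 1: "real b * q \<le> 2 * (B * \<Phi> z)" "2 * (B * \<Phi> z) \<le> real b * (real q + 1)"
      by simp_all
    have "real b > 0" using b by simp
    then have "q \<le> 2 * real b ^ l * \<Phi> z" "2 * real b ^ l * \<Phi> z \<le> real q + 1"
      using 1 mult_le_cancel_left_pos[of "real b"] by (simp_all add: B_def l mult_ac)
    then show ?thesis using b by (simp add: J_def field_simps)
  qed
  define V where "V z = takagi a b (\<Phi> z)" for z :: real
  \<comment> \<open>The fixed point of v = F + a^k v, where F is the constant value on J.\<close>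
  define y where "y = F (\<Phi> 0) / (1 - a ^ k)"
  have ak: "0 < a ^ k" "a ^ k < 1" using a power_Suc_less_one[of a l] by (simp_all add: l)
  have V: "V z = F (\<Phi> 0) + a ^ k * V (frac (b * z))" for z :: real
  proof -
    \<comment> \<open>If e z = 2r then B \<Phi>(z) is r plus the next coded point; if e z = 2r + 1
      it is r + 1 minus that point. Both have the same \<open>takagi\<close> value.\<close>
    have "takagi a b (B * \<Phi> z) = V (frac (b * z))"
    proof (cases "even (e z)")
      case True
      then obtain r where "e z = 2 * r" by blast
      then show ?thesis using rec[of z] takagi_add_int[of a b "int r"] by (simp add: V_def)
    next
      case False
      then obtain r where "e z = 2 * r + 1" using oddE by blast
      then show ?thesis using rec[of z] takagi_int_diff[of a b "int r + 1"]
        by (simp add: V_def add_divide_distrib add.commute)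
    qed
    then show ?thesis
      using takagi_split[OF a, of b "\<Phi> z" k] F[OF J[of z] J[of 0]] by (simp add: V_def F_def B_def)
  qed
  have y: "y = F (\<Phi> 0) + a ^ k * y" using ak by (simp add: y_def field_simps)
  define M where "M = 1 / (2 * (1 - a)) + \<bar>y\<bar>"
  \<comment> \<open>One step of the coding contracts the deviation from \<open>y\<close> by
    \<open>a ^ k\<close>, while \<open>M\<close> bounds it uniformly in \<open>z\<close>; iterating
    forces it to be 0.\<close>
  have M: "\<bar>V z - y\<bar> \<le> (a ^ k) ^ n * M" for n z
  proof (induction n arbitrary: z)
    case 0
    show ?case using takagi_bound[OF a, of b "\<Phi> z"] by (simp add: V_def M_def)
  next
    case (Suc n)
    have "V z - y = a ^ k * (V (frac (b * z)) - y)"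
      using V[of z] y by (simp add: algebra_simps)
    then have "\<bar>V z - y\<bar> = a ^ k * \<bar>V (frac (b * z)) - y\<bar>" using ak by (simp add: abs_mult)
    also have "\<dots> \<le> a ^ k * ((a ^ k) ^ n * M)" using Suc ak by (intro mult_left_mono) auto
    finally show ?case by simp
  qed
  have Vy: "V z = y" for z :: real
  proof -
    have "(\<lambda>n. (a ^ k) ^ n * M) \<longlonglongrightarrow> 0 * M"
      using ak by (intro tendsto_mult LIMSEQ_power_zero tendsto_const) simp
    then have "\<bar>V z - y\<bar> \<le> 0 * M" using M by (intro LIMSEQ_le_const) auto
    then show ?thesis by simp
  qed
  have "hausdorff_dim (takagi_level_set a b y) \<ge> ereal (1 / k)"
  \<comment> \<open>With c = 1/2, a set of diameter at most c / B^n spans at most one cell length 1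
    / (2 B^n). Cell indices then differ by at most 2 from a reference index, leaving 5
    possibilities.\<close>
  proof (rule hausdorff_dim_ge[where f = "\<lambda>z. (\<Phi> z, y)" and b = b and N = 5 and c = "1 / 2"])
    show "(\<lambda>z. (\<Phi> z, y)) ` {0..<1} \<subseteq> takagi_level_set a b y"
      using Vy \<Phi> order_trans[OF \<Phi>(2), of 1] by (auto simp: takagi_level_set_def V_def)
  next
    fix U :: "(real \<times> real) set" and n
    assume U: "bounded U" "diameter U \<le> 1 / 2 / (real b ^ k) ^ n"
    define P where "P = {z \<in> {0..<1}. (\<Phi> z, y) \<in> U}"
    have rec': "B * \<Phi> z = (let e = b * q + nat \<lfloor>b * frac z\<rfloor> in
        if even e then e / 2 + \<Phi> (frac (b * z)) else (real e + 1) / 2 - \<Phi> (frac (b * z)))" for z :: real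
      using rec[of z] by (simp add: e_def Let_def)
    have B0: "B > 0" using B by simp
    obtain m :: "real \<Rightarrow> nat" where lo: "\<And>z::real. m z \<le> 2 * real B ^ n * \<Phi> z" and hi: "\<And>z::real. 2 * real B ^ n * \<Phi> z \<le> real (m z) + 1"
      and inj: "\<And>(z::real) z'::real. \<lbrakk>z \<in> {0..<1}; z' \<in> {0..<1}; m z = m z'\<rbrakk>
          \<Longrightarrow> \<lfloor>real b ^ n * z\<rfloor> = \<lfloor>real b ^ n * z'\<rfloor>"
      by (rule folded_coding_index[OF B0 e[unfolded e_def] \<Phi> rec', of n]) (rule that)
    define I where "I = (\<lambda>z. \<lfloor>real b ^ n * z\<rfloor>) ` P"
    have "finite I \<and> card I \<le> 5"
    proof (cases "P = {}")
      case False
      then obtain z0 where z0: "z0 \<in> P" by blast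
      have near: "int (m z) \<in> {int (m z0) - 2..int (m z0) + 2}" if z: "z \<in> P" for z :: real
      proof -
        have "\<bar>\<Phi> z - \<Phi> z0\<bar> \<le> diameter U"
          using diameter_bounded_bound[OF U(1), of "(\<Phi> z, y)" "(\<Phi> z0, y)"] z z0
          by (simp add: P_def dist_Pair_Pair dist_real_def)
        also have "\<dots> \<le> 1 / 2 / B ^ n" using U(2) by (simp add: B_def)
        finally have "2 * real B ^ n * \<bar>\<Phi> z - \<Phi> z0\<bar> \<le> 1" using B by (simp add: field_simps)
        then have "\<bar>2 * real B ^ n * \<Phi> z - 2 * real B ^ n * \<Phi> z0\<bar> \<le> 1"
          by (simp add: abs_mult flip: right_diff_distrib)
        then show ?thesis using lo[of z] hi[of z] lo[of z0] hi[of z0] by auto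
      qed
      \<comment> \<open>Equal indices give equal digits, so the digits factor through the index and
        \<open>I\<close> has no more elements than there are indices.\<close>
      have "\<exists>h. \<forall>z\<in>P. \<lfloor>real b ^ n * z\<rfloor> = h (int (m z))"
      proof (intro exI ballI)
        fix z assume z: "z \<in> P"
        define z' where "z' = (SOME z'. z' \<in> P \<and> int (m z') = int (m z))"
        have "z' \<in> P \<and> int (m z') = int (m z)" unfolding z'_def by (rule someI[of _ z]) (use z in simp)
        then have "\<lfloor>real b ^ n * z\<rfloor> = \<lfloor>real b ^ n * z'\<rfloor>"
          using z by (intro inj) (auto simp: P_def)
        then show "\<lfloor>real b ^ n * z\<rfloor> = (\<lambda>i. \<lfloor>real b ^ n * (SOME z'. z' \<in> P \<and> int (m z') = i)\<rfloor>) (int (m z))"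
          by (simp add: z'_def)
      qed
      then obtain h where h: "\<And>z::real. z \<in> P \<Longrightarrow> \<lfloor>real b ^ n * z\<rfloor> = h (int (m z))" by blast
      have sub: "I \<subseteq> h ` {int (m z0) - 2..int (m z0) + 2}"
        using near h unfolding I_def by blast
      then have "card I \<le> card (h ` {int (m z0) - 2..int (m z0) + 2})" by (intro card_mono) auto
      also have "\<dots> \<le> card {int (m z0) - 2..int (m z0) + 2}" by (intro card_image_le) simp
      also have "\<dots> = 5" by simp
      finally show ?thesis using sub finite_subset by blast
    qed (simp add: I_def)
    then have I: "finite I" "card I \<le> 5" by auto
    obtain Q where Q: "Q \<in> sets lborel" "P \<subseteq> Q" "emeasure lborel Q \<le> ennreal (card I / b ^ n)"
      using cover_by_digit_intervals[of b I P n] b I(1) by (auto simp: I_def)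
    have "emeasure lborel Q \<le> ennreal (5 / b ^ n)"
      using Q(3) I(2) by (elim order_trans, intro ennreal_leI divide_right_mono) auto
    then show "\<exists>Q\<in>sets lborel. {z \<in> {0..<1}. (\<Phi> z, y) \<in> U} \<subseteq> Q \<and>
        emeasure lborel Q \<le> ennreal (5 / real b ^ n)"
      using Q(1,2) unfolding P_def by auto
  qed (use b k in auto)
  then show ?thesis by blast
qed

theorem theorem1p3:
  fixes a b :: real and k :: nat and \<epsilon> :: "nat \<Rightarrow> real"
  assumes "a < 1"
    and "a * b \<ge> 1"
    and "b \<in> \<int>" and "b > 2"
    and "k \<ge> 1"
    and "\<forall>n<k. \<epsilon> n \<in> {-1, 1}"
    and "(\<Sum>n<k. \<epsilon> n * (a * b) ^ n) = 0"
  shows "\<exists>y::real. hausdorff_dim (takagi_level_set a b y) \<ge> ereal (1 / real k)"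
proof -
  obtain i :: int where "b = i" using assms(3) Ints_cases by blast
  then obtain \<beta> :: nat where \<beta>: "b = \<beta>" using assms(4) by (intro that[of "nat i"]) simp
  have "a > 0"
  proof (rule ccontr)
    assume "\<not> a > 0"
    then have "a * b \<le> 0" using assms(4) by (intro mult_nonpos_nonneg) auto
    then show False using assms(2) by simp
  qed
  \<comment> \<open>Multiplying all signs by \<open>\<epsilon> 0\<close> makes the first one 1 and
    keeps \<open>a * b\<close> a root.\<close>
  moreover have "\<epsilon> 0 \<in> {-1, 1}" using assms(5,6) by simp
  then have "\<epsilon> 0 * \<epsilon> 0 = 1" by auto
  moreover have "\<forall>n<k. \<epsilon> 0 * \<epsilon> n \<in> {-1, 1}" using assms(6) \<open>\<epsilon> 0 \<in> {-1, 1}\<close> by fastforce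
  moreover have "(\<Sum>n<k. \<epsilon> 0 * \<epsilon> n * (a * \<beta>) ^ n) = 0"
    using assms(7) by (simp add: \<beta> mult.assoc flip: sum_distrib_left)
  ultimately show ?thesis
    using takagi_level_set_dim[of a \<beta> k "\<lambda>n. \<epsilon> 0 * \<epsilon> n"] assms(1,4,5) \<beta> by simp
qed

end
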